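(* For any $p := p(n) \in [0,1]$, $$\mathbb{P}\big[\,|\log r(G_{n,p}) - \mathbb{E}(\log r(G_{n,p}))| = \omega(\sqrt{n} \log n)\big] = o(1).$$ That is, for every function $g:\mathbb{N}\to(0,\infty)$ with $g(n)/(\sqrt{n}\log n) \to \infty$ as $n \to \infty$, the probability $\mathbb{P}\big[|\log r(G_{n,p(n)}) - \mathbb{E}(\log r(G_{n,p(n)}))| \geq g(n)\big]$ tends to $0$ as $n\to\infty$.
   Context: $\log$ is base $2$. The Ramsey number $r(H)$ of a graph $H$ is the smallest natural number $N$ such that any two-coloring of the edges of $K_N$ contains a monochromatic copy of $H$. $G_{n,p}$ is the binomial random graph on $n$ vertices, in which each of the possible edges is included independently with probability $p$. *)

theory Defs
  imports "HOL-Probability.Probability" "HOL-Library.Ramsey"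
begin

text \<open>
  A finite simple graph is given by a finite vertex set \<open>V\<close> and an edge set
  \<open>E \<subseteq> [V]\<^bsup>2\<^esup>\<close>, where \<open>[V]\<^bsup>2\<^esup>\<close> (\<open>nsets V 2\<close>) is the set of two-element subsets of \<open>V\<close>;
  thus \<open>K\<^sub>N\<close> is \<open>({..<N}, [{..<N}]\<^bsup>2\<^esup>)\<close>.
\<close>

text \<open>
  A copy of a graph is a subgraph, not necessarily induced. The embedding is injective on all
  vertices, so isolated vertices count: \<open>K\<^sub>N\<close> has a copy of an edgeless graph on \<open>n\<close>
  vertices only if \<open>N \<ge> n\<close>.
\<close>

definition has_mono_copy :: "nat \<Rightarrow> (nat set \<Rightarrow> bool) \<Rightarrow> 'a set \<Rightarrow> 'a set set \<Rightarrow> bool" where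
  "has_mono_copy N c V E \<longleftrightarrow>
     (\<exists>f. inj_on f V \<and> f ` V \<subseteq> {..<N} \<and> (\<exists>i. \<forall>e\<in>E. c (f ` e) = i))"

text \<open>
  The colouring \<open>c\<close> is a total function, but only its values on \<open>[{..<N}]\<^bsup>2\<^esup>\<close> matter when
  \<open>E \<subseteq> [V]\<^bsup>2\<^esup>\<close>.
\<close>

definition ramsey_number :: "'a set \<Rightarrow> 'a set set \<Rightarrow> nat" where
  "ramsey_number V E = (LEAST N. \<forall>c :: nat set \<Rightarrow> bool. has_mono_copy N c V E)"

text \<open>The minimum is over a nonempty set.\<close>

lemma ex_ramsey_number:
  assumes "finite V" "E \<subseteq> [V]\<^bsup>2\<^esup>"
  shows "\<exists>N. \<forall>c :: nat set \<Rightarrow> bool. has_mono_copy N c V E"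
proof -
  obtain N :: nat where N: "partn_lst {..<N} [card V, card V] 2"
    using ramsey2_full by blast
  have "has_mono_copy N c V E" for c :: "nat set \<Rightarrow> bool"
  proof -
    define d :: "nat set \<Rightarrow> nat" where "d = (\<lambda>e. if c e then 1 else 0)"
    have "d \<in> [{..<N}]\<^bsup>2\<^esup> \<rightarrow> {..<2}"
      by (auto simp: d_def)
    then obtain i H where i: "i < 2" and H: "H \<in> nsets {..<N} ([card V, card V] ! i)"
      and d: "d ` [H]\<^bsup>2\<^esup> \<subseteq> {i}"
      by (rule partn_lstE[OF N, of d 2]) (simp_all add: numeral_2_eq_2)
    have "[card V, card V] ! i = card V"
      using i by (auto simp: less_2_cases_iff)
    then have HN: "H \<subseteq> {..<N}" "finite H" "card H = card V"
      using H by (auto simp: nsets_def)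
    then obtain f where f: "bij_betw f V H"
      using assms(1) by (metis finite_same_card_bij)
    have "c (f ` e) = (i = 1)" if "e \<in> E" for e
    proof -
      have e: "e \<subseteq> V" "finite e" "card e = 2"
        using that assms(2) by (auto simp: nsets_def)
      moreover have "inj_on f e"
        using f e(1) by (meson bij_betw_def inj_on_subset)
      ultimately have "f ` e \<in> [H]\<^bsup>2\<^esup>"
        using f by (auto simp: nsets_def card_image bij_betw_def)
      then have "d (f ` e) = i"
        using d by blast
      then show ?thesis
        by (auto simp: d_def split: if_splits)
    qed
    then show ?thesis
      using f HN(1) unfolding has_mono_copy_def bij_betw_def by blast
  qed
  then show ?thesis by blast
qed

text \<open>
  \<open>G\<^sub>n\<^sub>,\<^sub>p\<close> on the vertex set \<open>{..<n}\<close>, as a distribution on edge sets: \<open>b\<close> holds one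
  independent Bernoulli variable per possible edge.
\<close>

definition gnp :: "nat \<Rightarrow> real \<Rightarrow> nat set set pmf" where
  "gnp n p =
     map_pmf (\<lambda>b. {e \<in> [{..<n}]\<^bsup>2\<^esup>. b e})
       (Pi_pmf ([{..<n}]\<^bsup>2\<^esup>) False (\<lambda>_. bernoulli_pmf p))"

definition log_ramsey :: "nat \<Rightarrow> nat set set \<Rightarrow> real" where
  "log_ramsey n E = log 2 (real (ramsey_number {..<n} E))"

end

theory Submission
  imports Defs
begin

text \<open>
  The proof combines a deterministic stability property of Ramsey numbers with a second-moment
  bound.

  Stability: if two graphs on the same \<open>n\<close> vertices differ only in edges at one vertex \<open>v\<close>, then
  their Ramsey numbers differ by a factor of at most \<open>3n\<close> (\<open>ramsey_number_change_vertex\<close>), so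
  \<open>log r\<close> changes by \<open>O(log n)\<close>. To see this, let \<open>r\<close> be the Ramsey number of the second graph and
  suppose that a colouring of \<open>K\<^sub>N\<close>, with \<open>N = 2nr + 1\<close>, has no monochromatic copy of the first.
  Some vertex has, in one of the colours (say blue), a neighbourhood \<open>W\<close> of size at least \<open>nr\<close>. Any
  \<open>r\<close> vertices contain a monochromatic copy of the second graph, and if those vertices all lie in
  the neighbourhood of some vertex \<open>u\<close> in the colour of that copy, then moving \<open>v\<close> to \<open>u\<close> gives a
  copy of the first graph. Hence all such copies inside \<open>W\<close> are red, and so every vertex of \<open>W\<close> has
  fewer than \<open>r\<close> red neighbours in \<open>W\<close>. As \<open>|W| \<ge> nr\<close>, a greedy choice gives a blue clique on \<open>n\<close>
  vertices, which contains every graph on \<open>n\<close> vertices.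

  Concentration: group the potential edges by their larger endpoint. The random graph is then a
  family of \<open>n\<close> independent blocks, and resampling one block changes only edges at a single vertex.
  A bounded-differences form of the Efron--Stein inequality (\<open>variance_Pi_pmf_blocks\<close>) bounds the
  variance of \<open>log r\<close> by \<open>n (log (3n))\<^sup>2\<close>, and Chebyshev's inequality finishes the proof: the
  probability is at most \<open>n (log (3n))\<^sup>2 / g(n)\<^sup>2\<close>.
\<close>

section \<open>Ramsey numbers under changes at one vertex\<close>

lemma has_mono_copyI:
  assumes "inj_on f V" "f ` V \<subseteq> {..<N}" "\<And>e. e \<in> E \<Longrightarrow> c (f ` e) = i"
  shows "has_mono_copy N c V E"
  unfolding has_mono_copy_def using assms by (intro exI[of _ f] conjI exI[of _ i] ballI)

lemma has_mono_copy_ramsey_number: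
  assumes "finite V" "E \<subseteq> [V]\<^bsup>2\<^esup>"
  shows "has_mono_copy (ramsey_number V E) c V E"
  using LeastI_ex[OF ex_ramsey_number[OF assms]] unfolding ramsey_number_def by blast

lemma ramsey_number_pos:
  assumes "finite V" "V \<noteq> {}" "E \<subseteq> [V]\<^bsup>2\<^esup>"
  shows "0 < ramsey_number V E"
proof (rule ccontr)
  assume "\<not> 0 < ramsey_number V E"
  then have "has_mono_copy 0 (\<lambda>_. True) V E"
    using has_mono_copy_ramsey_number[OF assms(1,3), of "\<lambda>_. True"] by simp
  then show False using assms(2) by (simp add: has_mono_copy_def)
qed

text \<open>
  The defining property of the Ramsey number speaks of the vertex set \<open>{..<N}\<close>; pulling the colouring
  back along an injection of \<open>{..<N}\<close> into \<open>S\<close> transfers it to any sufficiently large set.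
\<close>

lemma mono_copy_in_large_set:
  fixes c :: "nat set \<Rightarrow> bool"
  assumes "finite V" "E \<subseteq> [V]\<^bsup>2\<^esup>" "ramsey_number V E \<le> card S" "finite S"
  obtains f i where "inj_on f V" "f ` V \<subseteq> S" "\<And>e. e \<in> E \<Longrightarrow> c (f ` e) = i"
proof -
  let ?r = "ramsey_number V E"
  obtain h where h: "inj_on h {..<?r}" "h ` {..<?r} \<subseteq> S"
    using card_le_inj[of "{..<?r}" S] assms by auto
  have "has_mono_copy ?r (\<lambda>e. c (h ` e)) V E"
    by (rule has_mono_copy_ramsey_number) fact+
  then obtain f i where f: "inj_on f V" "f ` V \<subseteq> {..<?r}" "\<And>e. e \<in> E \<Longrightarrow> c (h ` f ` e) = i"
    unfolding has_mono_copy_def by blast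
  show thesis
  proof (rule that[of "h \<circ> f" i])
    show "inj_on (h \<circ> f) V"
      using f h by (meson comp_inj_on inj_on_subset)
    show "(h \<circ> f) ` V \<subseteq> S"
      using f h by force
    show "c ((h \<circ> f) ` e) = i" if "e \<in> E" for e
      using f(3)[OF that] by (simp add: image_comp)
  qed
qed

text \<open>
  Greedy choice: keeping one element and discarding the elements not related to it costs at most
  \<open>r\<close> elements.
\<close>

lemma greedy_clique:
  assumes "finite W" "k * r \<le> card W" "0 < r" "symp Q"
    and "\<And>w. w \<in> W \<Longrightarrow> card {x \<in> W. x \<noteq> w \<and> \<not> Q w x} < r"
  shows "\<exists>K \<subseteq> W. card K = k \<and> (\<forall>x\<in>K. \<forall>y\<in>K. x \<noteq> y \<longrightarrow> Q x y)"
  using assms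
proof (induction k arbitrary: W)
  case 0
  then show ?case by (intro exI[of _ "{}"]) auto
next
  case (Suc k)
  have "W \<noteq> {}" using Suc.prems(2,3) by auto
  then obtain w where w: "w \<in> W" by blast
  let ?U = "{x \<in> W. x \<noteq> w \<and> Q w x}" and ?B = "{x \<in> W. x \<noteq> w \<and> \<not> Q w x}"
  have "card (W - {w}) = card (?U \<union> ?B)"
    by (rule arg_cong[of _ _ card]) auto
  also have "\<dots> \<le> card ?U + card ?B" by (rule card_Un_le)
  finally have "k * r \<le> card ?U"
    using Suc.prems(2) Suc.prems(5)[OF w] Suc.prems(1) w by simp
  moreover have "card {x \<in> ?U. x \<noteq> u \<and> \<not> Q u x} < r" if "u \<in> ?U" for u
  proof -
    have "card {x \<in> ?U. x \<noteq> u \<and> \<not> Q u x} \<le> card {x \<in> W. x \<noteq> u \<and> \<not> Q u x}"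
      by (rule card_mono) (use Suc.prems(1) in auto)
    then show ?thesis using Suc.prems(5)[of u] that by simp
  qed
  moreover have "finite ?U" using Suc.prems(1) by simp
  ultimately have "\<exists>K \<subseteq> ?U. card K = k \<and> (\<forall>x\<in>K. \<forall>y\<in>K. x \<noteq> y \<longrightarrow> Q x y)"
    by (intro Suc.IH[of ?U] Suc.prems(3,4))
  then obtain K where K: "K \<subseteq> ?U" "card K = k" "\<forall>x\<in>K. \<forall>y\<in>K. x \<noteq> y \<longrightarrow> Q x y"
    by blast
  have fK: "finite K"
    by (rule finite_subset[OF K(1)]) (use Suc.prems(1) in simp)
  have "card (insert w K) = Suc k"
    using K fK by (subst card_insert_disjoint) auto
  moreover have "\<forall>x\<in>insert w K. \<forall>y\<in>insert w K. x \<noteq> y \<longrightarrow> Q x y"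
    using K Suc.prems(4) by (auto dest: sympD)
  ultimately show ?case
    using K(1) w by (intro exI[of _ "insert w K"]) auto
qed

text \<open>
  The images of the edges of \<open>E\<close> at \<open>v\<close> under the modified embedding \<open>f(v := u)\<close> join \<open>u\<close> to
  vertices of \<open>S\<close>; all other edges of \<open>E\<close> are edges of \<open>F\<close> and keep their images under \<open>f\<close>.
\<close>

lemma mono_copy_move_vertex:
  assumes E: "E \<subseteq> [V]\<^bsup>2\<^esup>" and EF: "{e \<in> E. v \<notin> e} \<subseteq> F"
    and f: "inj_on f V" "f ` V \<subseteq> S" "\<And>e. e \<in> F \<Longrightarrow> c (f ` e) = i"
    and u: "u < N" "u \<notin> S" "S \<subseteq> {..<N}" "\<And>w. w \<in> S \<Longrightarrow> c {u, w} = i"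
  shows "has_mono_copy N c V E"
proof (rule has_mono_copyI)
  let ?f = "f(v := u)"
  have "u \<notin> f ` V" using f(2) u(2) by blast
  then show "inj_on ?f V"
    by (intro inj_on_fun_updI f(1))
  show "?f ` V \<subseteq> {..<N}"
    using f(2) u(1,3) by (auto simp: fun_upd_def)
  show "c (?f ` e) = i" if e: "e \<in> E" for e
  proof (cases "v \<in> e")
    case True
    have "e \<subseteq> V" "card e = 2" using e E by (auto simp: nsets_def)
    then obtain x where "e = {v, x}" "x \<noteq> v" "x \<in> V"
      using True by (auto simp: card_2_iff)
    then have "?f ` e = {u, f x}" "f x \<in> S" using f(2) by auto
    then show ?thesis using u(4) by simp
  next
    case False
    then have "?f ` e = f ` e" by (intro image_cong) auto
    moreover have "e \<in> F" using EF e False by blast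
    ultimately show ?thesis using f(3) by simp
  qed
qed

lemma mono_copy_in_mono_clique:
  assumes "finite V" "E \<subseteq> [V]\<^bsup>2\<^esup>" "K \<subseteq> {..<N}" "card K = card V"
    and "\<And>x y. x \<in> K \<Longrightarrow> y \<in> K \<Longrightarrow> x \<noteq> y \<Longrightarrow> c {x, y} = i"
  shows "has_mono_copy N c V E"
proof -
  have "finite K" using assms(3) finite_subset by blast
  then obtain f where f: "bij_betw f V K"
    using assms(1,4) by (metis finite_same_card_bij)
  have "c (f ` e) = i" if "e \<in> E" for e
  proof -
    have "e \<subseteq> V" "card e = 2" using that assms(2) by (auto simp: nsets_def)
    then obtain x y where xy: "e = {x, y}" "x \<noteq> y" "x \<in> V" "y \<in> V"
      by (auto simp: card_2_iff)
    then have "f x \<noteq> f y" "f x \<in> K" "f y \<in> K"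
      using f by (auto simp: bij_betw_def inj_on_def)
    then show ?thesis using assms(5) xy(1) by simp
  qed
  moreover have "inj_on f V" "f ` V \<subseteq> {..<N}"
    using f assms(3) by (simp_all add: bij_betw_def)
  ultimately show ?thesis by (intro has_mono_copyI)
qed

text \<open>
  \<open>E\<close> and \<open>F\<close> are related only away from \<open>v\<close>, and only in one direction, so that two graphs differing
  just at \<open>v\<close> can be compared both ways.
\<close>

lemma ramsey_number_change_vertex:
  assumes V: "finite V" "V \<noteq> {}" and E: "E \<subseteq> [V]\<^bsup>2\<^esup>" and F: "F \<subseteq> [V]\<^bsup>2\<^esup>"
    and EF: "{e \<in> E. v \<notin> e} \<subseteq> F"
  shows "ramsey_number V E \<le> 3 * card V * ramsey_number V F"
proof -
  let ?n = "card V" and ?r = "ramsey_number V F"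
  have r: "0 < ?r" by (rule ramsey_number_pos[OF V F])
  \<comment> \<open>Besides vertex \<open>0\<close>, \<open>2nr\<close> vertices remain, and at least half of them are joined to \<open>0\<close> in one
    colour.\<close>
  define N where "N = 2 * ?n * ?r + 1"
  have "has_mono_copy N c V E" for c :: "nat set \<Rightarrow> bool"
  proof (rule ccontr)
    assume no: "\<not> has_mono_copy N c V E"
    define A where "A i = {w \<in> {0<..<N}. c {0, w} = i}" for i
    have "A True \<union> A False = {0<..<N}" by (auto simp: A_def)
    then have "2 * ?n * ?r \<le> card (A True) + card (A False)"
      using card_Un_le[of "A True" "A False"] by (simp add: N_def)
    then have "?n * ?r \<le> card (A True) \<or> ?n * ?r \<le> card (A False)"
      by linarith
    then obtain i where i: "?n * ?r \<le> card (A i)" by blast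
    define W where "W = A i"
    have W: "W \<subseteq> {..<N}" "0 \<notin> W" "finite W" "\<And>w. w \<in> W \<Longrightarrow> c {0, w} = i"
      by (auto simp: W_def A_def)
    have few: "card {x \<in> W. x \<noteq> w \<and> c {w, x} \<noteq> i} < ?r" if w: "w \<in> W" for w
    proof (rule ccontr)
      let ?S = "{x \<in> W. x \<noteq> w \<and> c {w, x} \<noteq> i}"
      assume "\<not> card ?S < ?r"
      then have S: "?r \<le> card ?S" "finite ?S" using W(3) by simp_all
      obtain f j where f: "inj_on f V" "f ` V \<subseteq> ?S" "\<And>e. e \<in> F \<Longrightarrow> c (f ` e) = j"
      proof (rule mono_copy_in_large_set[OF V(1) F S, where c = c])
        fix f j
        assume "inj_on f V" "f ` V \<subseteq> ?S" and j: "\<And>e. e \<in> F \<Longrightarrow> c (f ` e) = j"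
        then show thesis by (intro that[of f j] j)
      qed
      have "has_mono_copy N c V E"
      proof (cases "j = i")
        case True
        show ?thesis
        proof (rule mono_copy_move_vertex[OF E EF f(1), where S = W and u = 0])
          show "f ` V \<subseteq> W" using f(2) by blast
          show "c (f ` e) = i" if "e \<in> F" for e using f(3)[OF that] True by simp
        qed (use W in \<open>simp_all add: N_def\<close>)
      next
        case False
        show ?thesis
        proof (rule mono_copy_move_vertex[OF E EF f(1,2), where u = w])
          show "c (f ` e) = j" if "e \<in> F" for e by (rule f(3)[OF that])
          show "w < N" "w \<notin> ?S" "?S \<subseteq> {..<N}" using w W(1) by auto
          show "c {w, x} = j" if "x \<in> ?S" for x using that False by simp
        qed
      qed
      with no show False ..
    qed
    have "symp (\<lambda>x y. c {x, y} = i)"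
      by (simp add: symp_def insert_commute)
    then obtain K where K: "K \<subseteq> W" "card K = ?n" "\<forall>x\<in>K. \<forall>y\<in>K. x \<noteq> y \<longrightarrow> c {x, y} = i"
      using greedy_clique[OF W(3) i[folded W_def] r, of "\<lambda>x y. c {x, y} = i"] few by blast
    have "has_mono_copy N c V E"
      by (rule mono_copy_in_mono_clique[OF V(1) E, of K N c i]) (use K W(1) in auto)
    with no show False ..
  qed
  then have "ramsey_number V E \<le> N"
    unfolding ramsey_number_def by (intro Least_le) blast
  moreover have "0 < ?n * ?r"
    using V r by (simp add: card_gt_0_iff)
  moreover have "3 * ?n * ?r = 2 * ?n * ?r + ?n * ?r" by algebra
  ultimately show ?thesis unfolding N_def by linarith
qed

lemma log_ramsey_change_vertex:
  assumes "0 < n" "E \<subseteq> [{..<n}]\<^bsup>2\<^esup>" "F \<subseteq> [{..<n}]\<^bsup>2\<^esup>"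
    and "{e \<in> E. v \<notin> e} = {e \<in> F. v \<notin> e}"
  shows "\<bar>log_ramsey n E - log_ramsey n F\<bar> \<le> log 2 (3 * real n)"
proof -
  have *: "log_ramsey n E \<le> log 2 (3 * real n) + log_ramsey n F"
    if E: "E \<subseteq> [{..<n}]\<^bsup>2\<^esup>" and F: "F \<subseteq> [{..<n}]\<^bsup>2\<^esup>" and EF: "{e \<in> E. v \<notin> e} \<subseteq> F" for E F
  proof -
    have ne: "{..<n} \<noteq> {}" using assms(1) by auto
    have pos: "0 < ramsey_number {..<n} E" "0 < ramsey_number {..<n} F"
      by (intro ramsey_number_pos ne E F finite_lessThan)+
    have "ramsey_number {..<n} E \<le> 3 * n * ramsey_number {..<n} F"
      using ramsey_number_change_vertex[OF finite_lessThan ne E F EF] by simp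
    then have "real (ramsey_number {..<n} E) \<le> (3 * real n) * real (ramsey_number {..<n} F)"
      by (metis of_nat_le_iff of_nat_mult of_nat_numeral)
    then have "log_ramsey n E \<le> log 2 ((3 * real n) * real (ramsey_number {..<n} F))"
      unfolding log_ramsey_def using pos by simp
    also have "\<dots> = log 2 (3 * real n) + log_ramsey n F"
      unfolding log_ramsey_def using pos assms(1) by (subst log_mult) auto
    finally show ?thesis .
  qed
  show ?thesis
    using *[OF assms(2,3)] *[OF assms(3,2)] assms(4) by (fastforce simp: abs_le_iff)
qed

section \<open>Variance under bounded differences\<close>

lemma expectation_pair_pmf:
  fixes f :: "'a \<times> 'b \<Rightarrow> real"
  assumes "finite (set_pmf P)" "finite (set_pmf Q)"
  shows "measure_pmf.expectation (pair_pmf P Q) f =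
    measure_pmf.expectation P (\<lambda>a. measure_pmf.expectation Q (\<lambda>b. f (a, b)))"
proof -
  have *: "pair_pmf P Q = P \<bind> (\<lambda>a. map_pmf (Pair a) Q)"
    by (simp add: pair_pmf_def map_pmf_def)
  show ?thesis
    unfolding * using assms
    by (subst pmf_expectation_bind[of "set_pmf P"])
       (auto simp: integral_measure_pmf[of "set_pmf P"])
qed

lemma variance_eq_finite_pmf:
  fixes f :: "'a \<Rightarrow> real"
  assumes "finite (set_pmf P)"
  shows "measure_pmf.variance P f =
    measure_pmf.expectation P (\<lambda>x. (f x)\<^sup>2) - (measure_pmf.expectation P f)\<^sup>2"
  by (rule measure_pmf.variance_eq) (rule integrable_measure_pmf_finite[OF assms])+

text \<open>The law of total variance, conditioning on the first component.\<close>

lemma variance_pair_pmf: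
  fixes f :: "'a \<times> 'b \<Rightarrow> real"
  assumes "finite (set_pmf P)" "finite (set_pmf Q)"
  shows "measure_pmf.variance (pair_pmf P Q) f =
    measure_pmf.expectation P (\<lambda>a. measure_pmf.variance Q (\<lambda>b. f (a, b))) +
    measure_pmf.variance P (\<lambda>a. measure_pmf.expectation Q (\<lambda>b. f (a, b)))"
proof -
  have "finite (set_pmf (pair_pmf P Q))" using assms by simp
  note eqs = variance_eq_finite_pmf[OF this] variance_eq_finite_pmf[OF assms(1)]
    variance_eq_finite_pmf[OF assms(2)]
  show ?thesis
    unfolding eqs unfolding expectation_pair_pmf[OF assms]
    by (subst Bochner_Integration.integral_diff)
       (simp_all add: integrable_measure_pmf_finite[OF assms(1)])
qed

lemma expectation_dist_le:
  fixes f g :: "'a \<Rightarrow> real" and D :: real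
  assumes "finite (set_pmf P)" "\<And>x. \<bar>f x - g x\<bar> \<le> D"
  shows "\<bar>measure_pmf.expectation P f - measure_pmf.expectation P g\<bar> \<le> D"
proof -
  note int = integrable_measure_pmf_finite[OF assms(1)]
  have "\<bar>measure_pmf.expectation P f - measure_pmf.expectation P g\<bar> =
      \<bar>measure_pmf.expectation P (\<lambda>x. f x - g x)\<bar>"
    by (simp add: Bochner_Integration.integral_diff int)
  also have "\<dots> \<le> measure_pmf.expectation P (\<lambda>x. \<bar>f x - g x\<bar>)"
    by (rule integral_abs_bound)
  also have "\<dots> \<le> D"
    by (rule measure_pmf.integral_le_const) (use assms int in auto)
  finally show ?thesis .
qed

lemma variance_le_oscillation:
  fixes f :: "'a \<Rightarrow> real" and D :: real
  assumes "finite (set_pmf P)" "\<And>x y. \<bar>f x - f y\<bar> \<le> D"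
  shows "measure_pmf.variance P f \<le> D\<^sup>2"
proof (rule measure_pmf.integral_le_const)
  have "\<bar>f x - measure_pmf.expectation P f\<bar> \<le> D" for x
    using expectation_dist_le[OF assms(1), of "\<lambda>_. f x" f D] assms(2) by simp
  then have "(f x - measure_pmf.expectation P f)\<^sup>2 \<le> D\<^sup>2" for x
    by (metis abs_ge_zero power2_abs power_mono)
  then show "AE x in measure_pmf P. (f x - measure_pmf.expectation P f)\<^sup>2 \<le> D\<^sup>2" by simp
qed (rule integrable_measure_pmf_finite[OF assms(1)])

text \<open>
  Split off one block and condition on all the others. The conditional variance is at most \<open>D\<^sup>2\<close>
  because \<open>f\<close> then oscillates by at most \<open>D\<close>; and averaging \<open>f\<close> over the block gives a function
  that still changes by at most \<open>D\<close> in each of the other blocks, to which induction applies.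
\<close>

lemma variance_Pi_pmf_blocks:
  fixes f :: "('a \<Rightarrow> 'b) \<Rightarrow> real" and S :: "'i \<Rightarrow> 'a set" and D :: real
  assumes "finite I" "\<And>i. i \<in> I \<Longrightarrow> finite (S i)" "disjoint_family_on S I"
    and "\<And>x. finite (set_pmf (p x))"
    and "\<And>i x y. i \<in> I \<Longrightarrow> (\<And>e. e \<notin> S i \<Longrightarrow> x e = y e) \<Longrightarrow> \<bar>f x - f y\<bar> \<le> D"
  shows "measure_pmf.variance (Pi_pmf (\<Union>i\<in>I. S i) d p) f \<le> card I * D\<^sup>2"
  using assms
proof (induction I arbitrary: f rule: finite_induct)
  case empty
  then show ?case by simp
next
  case (insert i I)
  let ?A = "\<Union>i\<in>I. S i"
  let ?P = "Pi_pmf ?A d p" and ?Q = "Pi_pmf (S i) d p"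
  define F where "F = (\<lambda>(a, b). f (\<lambda>x. if x \<in> ?A then a x else b x))"
  have fin: "finite ?A" "finite (S i)" using insert by auto
  have disj: "?A \<inter> S i = {}"
    using insert.hyps(2) insert.prems(2) unfolding disjoint_family_on_def by fastforce
  have finP: "finite (set_pmf ?P)" and finQ: "finite (set_pmf ?Q)"
    using fin insert.prems(3) by (auto simp: set_Pi_pmf intro!: finite_PiE_dflt)
  have *: "Pi_pmf (\<Union>i\<in>insert i I. S i) d p =
      map_pmf (\<lambda>(a, b) x. if x \<in> ?A then a x else b x) (pair_pmf ?P ?Q)"
    using Pi_pmf_union[OF fin disj, of d p] by (simp add: Un_commute)
  have "measure_pmf.variance (Pi_pmf (\<Union>i\<in>insert i I. S i) d p) f =
      measure_pmf.variance (pair_pmf ?P ?Q) F"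
    unfolding * F_def by (simp add: case_prod_unfold)
  also have "\<dots> = measure_pmf.expectation ?P (\<lambda>a. measure_pmf.variance ?Q (\<lambda>b. F (a, b))) +
      measure_pmf.variance ?P (\<lambda>a. measure_pmf.expectation ?Q (\<lambda>b. F (a, b)))"
    by (rule variance_pair_pmf[OF finP finQ])
  also have "measure_pmf.expectation ?P (\<lambda>a. measure_pmf.variance ?Q (\<lambda>b. F (a, b))) \<le> D\<^sup>2"
  proof (rule measure_pmf.integral_le_const[OF integrable_measure_pmf_finite[OF finP]])
    \<comment> \<open>The oscillation bound is required for arbitrary functions \<open>b\<close>, while \<open>F (a, b)\<close> also reads \<open>b\<close>
      outside the block; resetting \<open>b\<close> to \<open>d\<close> there does not affect samples from \<open>?Q\<close>.\<close>
    define G where "G a b = F (a, \<lambda>x. if x \<in> S i then b x else d)" for a b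
    have "\<bar>G a b - G a b'\<bar> \<le> D" for a b b'
      unfolding G_def F_def by (simp only: prod.case, rule insert.prems(4)[of i]) auto
    then have "measure_pmf.variance ?Q (G a) \<le> D\<^sup>2" for a
      by (intro variance_le_oscillation finQ)
    moreover have "measure_pmf.variance ?Q (G a) = measure_pmf.variance ?Q (\<lambda>b. F (a, b))" for a
    proof -
      have eq: "G a b = F (a, b)" if "b \<in> set_pmf ?Q" for b
      proof -
        have "(\<lambda>x. if x \<in> S i then b x else d) = b"
          using that set_Pi_pmf_subset[OF fin(2), of d p] by (intro ext) auto
        then show ?thesis by (simp add: G_def)
      qed
      have "measure_pmf.expectation ?Q (G a) = measure_pmf.expectation ?Q (\<lambda>b. F (a, b))"
        by (rule integral_cong_AE) (auto simp: AE_measure_pmf_iff eq)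
      then show ?thesis
        by (intro integral_cong_AE) (auto simp: AE_measure_pmf_iff eq)
    qed
    ultimately show "AE a in ?P. measure_pmf.variance ?Q (\<lambda>b. F (a, b)) \<le> D\<^sup>2" by simp
  qed
  also have "measure_pmf.variance ?P (\<lambda>a. measure_pmf.expectation ?Q (\<lambda>b. F (a, b))) \<le> card I * D\<^sup>2"
  proof (rule insert.IH)
    show "disjoint_family_on S I"
      using insert.prems(2) by (auto simp: disjoint_family_on_def)
    fix j and x y :: "'a \<Rightarrow> 'b"
    assume j: "j \<in> I" and xy: "\<And>e. e \<notin> S j \<Longrightarrow> x e = y e"
    show "\<bar>measure_pmf.expectation ?Q (\<lambda>b. F (x, b)) - measure_pmf.expectation ?Q (\<lambda>b. F (y, b))\<bar> \<le> D"
      by (rule expectation_dist_le[OF finQ], unfold F_def prod.case,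
          rule insert.prems(4)[of j]) (use j xy in auto)
  qed (use insert.prems in auto)
  finally show ?case
    using insert.hyps by (simp add: algebra_simps)
qed

section \<open>Concentration for the random graph\<close>

text \<open>
  The vertex-exposure decomposition: the \<open>i\<close>-th block consists of the potential edges from \<open>i\<close> to
  smaller vertices.
\<close>

lemma variance_log_ramsey_gnp:
  assumes "0 < n"
  shows "measure_pmf.variance (gnp n p) (log_ramsey n) \<le> n * (log 2 (3 * real n))\<^sup>2"
proof -
  let ?U = "[{..<n}]\<^bsup>2\<^esup>"
  define S where "S i = {e \<in> ?U. Max e = i}" for i
  define f where "f = (\<lambda>b. log_ramsey n {e \<in> ?U. b e})"
  have mem: "Max e \<in> e" if "e \<in> ?U" for e
    using that by (intro Max_in) (auto simp: nsets_def)
  have U: "?U = (\<Union>i\<in>{..<n}. S i)"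
    using mem by (auto simp: S_def nsets_def)
  have "measure_pmf.variance (Pi_pmf (\<Union>i\<in>{..<n}. S i) False (\<lambda>_. bernoulli_pmf p)) f
      \<le> card {..<n} * (log 2 (3 * real n))\<^sup>2"
  proof (rule variance_Pi_pmf_blocks)
    show "finite (S i)" for i
      by (simp add: S_def finite_imp_finite_nsets)
    show "disjoint_family_on S {..<n}"
      by (auto simp: disjoint_family_on_def S_def)
    fix i and x y :: "nat set \<Rightarrow> bool"
    assume xy: "\<And>e. e \<notin> S i \<Longrightarrow> x e = y e"
    have "{e \<in> {e \<in> ?U. x e}. i \<notin> e} = {e \<in> {e \<in> ?U. y e}. i \<notin> e}"
    proof -
      have "x e = y e" if "e \<in> ?U" "i \<notin> e" for e
        using xy[of e] mem[of e] that by (auto simp: S_def)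
      then show ?thesis by blast
    qed
    then show "\<bar>f x - f y\<bar> \<le> log 2 (3 * real n)"
      unfolding f_def by (intro log_ramsey_change_vertex[OF assms]) auto
  qed auto
  then show ?thesis
    by (simp add: gnp_def f_def flip: U)
qed

lemma finite_set_pmf_gnp: "finite (set_pmf (gnp n p))"
proof (rule finite_subset)
  show "set_pmf (gnp n p) \<subseteq> Pow ([{..<n}]\<^bsup>2\<^esup>)" by (auto simp: gnp_def)
qed (simp add: finite_imp_finite_nsets)

lemma log_ramsey_gnp_tail:
  assumes "0 < n" "0 < t"
  shows "measure_pmf.prob (gnp n p)
      {E. \<bar>log_ramsey n E - measure_pmf.expectation (gnp n p) (log_ramsey n)\<bar> \<ge> t}
    \<le> n * (log 2 (3 * real n))\<^sup>2 / t\<^sup>2"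
proof -
  have "measure_pmf.prob (gnp n p)
      {E. \<bar>log_ramsey n E - measure_pmf.expectation (gnp n p) (log_ramsey n)\<bar> \<ge> t}
    \<le> measure_pmf.variance (gnp n p) (log_ramsey n) / t\<^sup>2"
    using measure_pmf.Chebyshev_inequality[of "log_ramsey n" "gnp n p" t] assms(2)
      integrable_measure_pmf_finite[OF finite_set_pmf_gnp, of n p "\<lambda>E. (log_ramsey n E)\<^sup>2"]
    by simp
  also have "\<dots> \<le> n * (log 2 (3 * real n))\<^sup>2 / t\<^sup>2"
    by (intro divide_right_mono variance_log_ramsey_gnp[OF assms(1)]) simp
  finally show ?thesis .
qed

theorem theorem5p1:
  fixes p g :: "nat \<Rightarrow> real"
  assumes "\<And>n. 0 \<le> p n" and "\<And>n. p n \<le> 1"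
    and "\<And>n. 0 < g n"
    and "filterlim (\<lambda>n. g n / (sqrt (real n) * log 2 (real n))) at_top sequentially"
  shows "(\<lambda>n. measure_pmf.prob (gnp n (p n))
            {E. \<bar>log_ramsey n E - measure_pmf.expectation (gnp n (p n)) (log_ramsey n)\<bar> \<ge> g n})
         \<longlonglongrightarrow> 0"
proof (rule tendsto_sandwich[of "\<lambda>_. 0"])
  let ?h = "\<lambda>n. g n / (sqrt (real n) * log 2 (real n))"
  have "(\<lambda>n. inverse (?h n)) \<longlonglongrightarrow> 0"
    using assms(4) by (rule filterlim_compose[OF tendsto_inverse_0_at_top[OF filterlim_ident]])
  then have "(\<lambda>n. 9 * (inverse (?h n))\<^sup>2) \<longlonglongrightarrow> 9 * 0\<^sup>2"
    by (intro tendsto_intros)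
  then show "(\<lambda>n. 9 * (inverse (?h n))\<^sup>2) \<longlonglongrightarrow> 0" by simp
  show "\<forall>\<^sub>F n in sequentially. measure_pmf.prob (gnp n (p n))
      {E. \<bar>log_ramsey n E - measure_pmf.expectation (gnp n (p n)) (log_ramsey n)\<bar> \<ge> g n}
    \<le> 9 * (inverse (?h n))\<^sup>2"
    using eventually_ge_at_top[of 2]
  proof eventually_elim
    case (elim n)
    have "2 * 2 \<le> real n * real n"
      using elim by (intro mult_mono) auto
    then have "3 * real n \<le> real n ^ 3"
      using mult_right_mono[of 3 "real n * real n" "real n"] by (simp add: power3_eq_cube)
    then have "log 2 (3 * real n) \<le> log 2 (real n ^ 3)"
      using elim by simp
    also have "\<dots> = 3 * log 2 (real n)"
      using elim by (simp add: log_nat_power)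
    finally have "(log 2 (3 * real n))\<^sup>2 \<le> (3 * log 2 (real n))\<^sup>2"
      using elim by (intro power_mono) auto
    then have "n * (log 2 (3 * real n))\<^sup>2 / (g n)\<^sup>2 \<le> n * (3 * log 2 (real n))\<^sup>2 / (g n)\<^sup>2"
      by (intro divide_right_mono mult_left_mono) auto
    also have "\<dots> = 9 * (inverse (?h n))\<^sup>2"
      by (simp add: power_mult_distrib power_divide)
    finally show ?case
      using log_ramsey_gnp_tail[of n "g n" "p n"] elim assms(3)[of n] by simp
  qed
qed auto

end
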